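(* The weak order on $S^{\mathfrak M}_\infty$ is a valid partial order.
   Context: $\mathrm{SC}(n)$ is the set of set compositions of $[n]$, i.e. words $w=w_1\cdots w_k$ of nonempty pairwise disjoint sets with union $[n]$; $\mathrm{SC}(\infty)=\bigcup_{n\ge1}\mathrm{SC}(n)$. An $\mathfrak M$-permutation of $[n]$ is a set composition of $[n]$ none of whose sets contains two consecutive integers; $S^{\mathfrak M}_\infty$ is the set of all of them. Standardization: for a set composition $w$, $\mathrm{st}(w)\in S^{\mathfrak M}_\infty$ is obtained by repeating the following until an $\mathfrak M$-permutation results: (R1) delete the letter $i+1$ if both $i$ and $i+1$ belong to some $w_j$; (R2) reduce all letters larger than $i$ by $1$ if the positive integer $i$ is not present in any $w_j$. Let $\sim$ be the equivalence relation on $\mathrm{SC}(\infty)$ generated by $w\sim\mathrm{st}(w)$; each class contains a unique $\mathfrak M$-permutation. For sets of integers write $a<b$ if $\max(a)<\min(b)$. The cover relation $\lessdot$ on $\mathrm{SC}(n)$ is given, for $w=w_1\cdots w_k$, by: (1) if $w_i<w_{i+1}$ then $w\lessdot w_1\cdots w_{i-1}\,(w_i\cup w_{i+1})\,w_{i+2}\cdots w_k$; (2) if $w_i=w_i'\sqcup w_i''$ is a disjoint union of nonempty subsets with $w_i'<w_i''$ then $w\lessdot w_1\cdots w_{i-1}\,w_i''\,w_i'\,w_{i+1}\cdots w_k$. The weak order $<$ on $S^{\mathfrak M}_\infty$ is the transitive closure of the relations: $w<v$ (for $w,v\in S^{\mathfrak M}_\infty$) if there exist set compositions $w'\sim w$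 and $v'\sim v$, in the same $\mathrm{SC}(n)$, with $w'\lessdot v'$. (It is a valid partial order when, together with equality, it is reflexive, antisymmetric and transitive.) *)

theory Defs
  imports Main
begin

type_synonym word = "nat set list"

definition SC :: "nat \<Rightarrow> word set" where
  "SC n = {w. {} \<notin> set w \<and> sorted_wrt disjnt w \<and> \<Union> (set w) = {1..n}}"

definition SC_inf :: "word set" where
  "SC_inf = (\<Union>n\<in>{1..}. SC n)"

definition M_perms :: "nat \<Rightarrow> word set" where
  "M_perms n = {w \<in> SC n. \<forall>B\<in>set w. \<nexists>i. i \<in> B \<and> i + 1 \<in> B}"

definition SM_inf :: "word set" where
  "SM_inf = (\<Union>n\<in>{1..}. M_perms n)"

(* The intermediate words of a standardization need not be set compositions of any [n]:
   after R1 a letter is missing. *)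
inductive st_step :: "word \<Rightarrow> word \<Rightarrow> bool" where
  R1: "\<lbrakk>j < length w; i \<in> w ! j; i + 1 \<in> w ! j\<rbrakk>
    \<Longrightarrow> st_step w (w[j := w ! j - {i + 1}])"
| R2: "\<lbrakk>1 \<le> i; i \<notin> \<Union> (set w)\<rbrakk>
    \<Longrightarrow> st_step w (map (\<lambda>B. (\<lambda>x. if x > i then x - 1 else x) ` B) w)"

(* The result is unique on SC_inf: for pairwise disjoint sets of positive integers, both rules
   preserve the sequence of positions of the blocks containing the letters, listed by increasing
   letter, with adjacent repetitions removed, and an M-permutation is determined by that
   sequence. On an M-permutation R1 never applies and R2 changes nothing, so reaching one by
   the closure is the same as stopping at the first one. *)
definition st :: "word \<Rightarrow> word" where
  "st w = (THE v. v \<in> SM_inf \<and> st_step\<^sup>*\<^sup>* w v)"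

definition sc_equiv :: "word \<Rightarrow> word \<Rightarrow> bool" where
  "sc_equiv w v \<longleftrightarrow> w \<in> SC_inf \<and> v \<in> SC_inf \<and>
     equivclp (\<lambda>x y. x \<in> SC_inf \<and> y = st x) w v"

(* Used only for finite nonempty sets, where Max and Min have their usual meaning. *)
definition set_less :: "nat set \<Rightarrow> nat set \<Rightarrow> bool" where
  "set_less A B \<longleftrightarrow> Max A < Min B"

inductive cover :: "nat \<Rightarrow> word \<Rightarrow> word \<Rightarrow> bool" for n where
  merge: "\<lbrakk>us @ A # B # vs \<in> SC n; set_less A B\<rbrakk>
    \<Longrightarrow> cover n (us @ A # B # vs) (us @ (A \<union> B) # vs)"
| split: "\<lbrakk>us @ (A \<union> B) # vs \<in> SC n; A \<noteq> {}; B \<noteq> {}; disjnt A B; set_less A B\<rbrakk>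
    \<Longrightarrow> cover n (us @ (A \<union> B) # vs) (us @ B # A # vs)"

definition weak_less :: "word rel" where
  "weak_less = {(w, v). w \<in> SM_inf \<and> v \<in> SM_inf \<and>
     (\<exists>n w' v'. w' \<in> SC n \<and> v' \<in> SC n \<and> sc_equiv w' w \<and> sc_equiv v' v \<and> cover n w' v')}\<^sup>+"

definition weak_order :: "word rel" where
  "weak_order = weak_less \<union> Id_on SM_inf"

end

theory Submission
  imports Defs
begin

text \<open>
  Record a set composition of \<open>[n]\<close> by the word \<open>a\<^sub>1 \<dots> a\<^sub>n\<close>, where \<open>a\<^sub>x\<close> is the position of the
  block containing the letter \<open>x\<close>. Standardization contracts adjacent repetitions in this word, so
  the contracted word \<open>red w\<close> is a complete invariant of the equivalence class. Along a cover
  relation the sign of \<open>a\<^sub>x - a\<^sub>y\<close> weakly increases for all \<open>x < y\<close>, and strictly for some. The sum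
  of these signs over adjacent \<open>x, y = x + 1\<close> does not change under contraction, so it is a weakly
  increasing function of the class. If it stays constant then all adjacent signs agree, hence both
  words contract at the same places and the sum of the signs over all pairs, now taken in the
  contracted words, strictly increases. The lexicographic combination of the two sums therefore
  excludes cycles.
\<close>

section \<open>Comparison signs and their sums under contraction\<close>

definition cmp :: "nat \<Rightarrow> nat \<Rightarrow> int" where
  "cmp x y = sgn (int x - int y)"

fun desc_excess :: "nat list \<Rightarrow> int" where
  "desc_excess (x # y # zs) = cmp x y + desc_excess (y # zs)"
| "desc_excess _ = 0"

fun inv_excess :: "nat list \<Rightarrow> int" where
  "inv_excess [] = 0"
| "inv_excess (x # xs) = (\<Sum>y\<leftarrow>xs. cmp x y) + inv_excess xs"

text \<open>A list of pairs carries two words of equal length at once. With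
  \<open>sorted_wrt\<close>, which tests all pairs of positions and not only neighbours, this
  relation says that every comparison sign weakly increases from the first word to the
  second.\<close>

definition cmp_le :: "nat \<times> nat \<Rightarrow> nat \<times> nat \<Rightarrow> bool" where
  "cmp_le p q \<longleftrightarrow> cmp (fst p) (fst q) \<le> cmp (snd p) (snd q)"

lemma cmp_refl [simp]: "cmp x x = 0"
  by (simp add: cmp_def)

lemma cmp_eq_0_iff [simp]: "cmp x y = 0 \<longleftrightarrow> x = y"
  by (simp add: cmp_def sgn_0_0)

lemma cmp_swap: "cmp y x = - cmp x y"
  by (simp add: cmp_def sgn_if)

lemma desc_excess_remdups_adj: "desc_excess (remdups_adj xs) = desc_excess xs"
proof (induction xs rule: remdups_adj.induct)
  case (3 x y xs)
  obtain zs where zs: "remdups_adj (y # xs) = y # zs"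
    by (metis remdups_adj_Cons_alt)
  with 3 show ?case
    by (cases "x = y") simp_all
qed simp_all

lemma desc_excess_mono:
  "sorted_wrt cmp_le ps \<Longrightarrow> desc_excess (map fst ps) \<le> desc_excess (map snd ps)"
  by (induction ps rule: remdups_adj.induct) (auto simp: cmp_le_def intro: add_mono)

text \<open>Terms that are ordered one by one and have equal sums are equal, so the adjacent signs
  agree. Repetitions are the signs 0. Both contracted words are therefore projections of one
  contracted list of pairs and can still be compared position by position.\<close>

lemma remdups_adj_map_fst_snd:
  assumes "sorted_wrt cmp_le ps" "desc_excess (map fst ps) = desc_excess (map snd ps)"
  shows "remdups_adj (map fst ps) = map fst (remdups_adj ps) \<and>
    remdups_adj (map snd ps) = map snd (remdups_adj ps)"
  using assms
proof (induction ps rule: remdups_adj.induct)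
  case (3 p q ps)
  have le: "cmp (fst p) (fst q) \<le> cmp (snd p) (snd q)"
    using 3(3) by (simp add: cmp_le_def)
  have le': "desc_excess (map fst (q # ps)) \<le> desc_excess (map snd (q # ps))"
    using 3(3) by (intro desc_excess_mono) simp
  have eq: "cmp (fst p) (fst q) = cmp (snd p) (snd q)"
    and eq': "desc_excess (map fst (q # ps)) = desc_excess (map snd (q # ps))"
    using le le' 3(4) by simp_all
  have "fst p = fst q \<longleftrightarrow> snd p = snd q"
    using eq by (metis cmp_eq_0_iff)
  then have "(fst p = fst q) = (p = q)" "(snd p = snd q) = (p = q)"
    by (auto simp: prod_eq_iff)
  then show ?case
    using 3(1,2,3) eq' by (cases "p = q") simp_all
qed simp_all

lemma sorted_wrt_remdups_adj: "sorted_wrt P xs \<Longrightarrow> sorted_wrt P (remdups_adj xs)"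
  by (induction xs rule: remdups_adj.induct) auto

lemma sum_list_cmp_mono:
  assumes "\<forall>q\<in>set ps. cmp_le p q"
  shows "(\<Sum>y\<leftarrow>map fst ps. cmp (fst p) y) \<le> (\<Sum>y\<leftarrow>map snd ps. cmp (snd p) y)"
  using assms by (induction ps) (auto simp: cmp_le_def intro: add_mono)

lemma sum_list_cmp_eq:
  assumes "\<forall>q\<in>set ps. cmp_le p q"
    and "(\<Sum>y\<leftarrow>map fst ps. cmp (fst p) y) = (\<Sum>y\<leftarrow>map snd ps. cmp (snd p) y)"
  shows "\<forall>q\<in>set ps. cmp (fst p) (fst q) = cmp (snd p) (snd q)"
  using assms
proof (induction ps)
  case (Cons q ps)
  have "(\<Sum>y\<leftarrow>map fst ps. cmp (fst p) y) \<le> (\<Sum>y\<leftarrow>map snd ps. cmp (snd p) y)"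
    using Cons.prems by (intro sum_list_cmp_mono) simp
  moreover have "cmp (fst p) (fst q) \<le> cmp (snd p) (snd q)"
    using Cons.prems by (simp add: cmp_le_def)
  ultimately show ?case
    using Cons by simp
qed simp

lemma inv_excess_mono:
  "sorted_wrt cmp_le ps \<Longrightarrow> inv_excess (map fst ps) \<le> inv_excess (map snd ps)"
proof (induction ps)
  case (Cons p ps)
  then show ?case
    using sum_list_cmp_mono[of ps p] by simp
qed simp

lemma inv_excess_eq:
  assumes "sorted_wrt cmp_le ps" "inv_excess (map fst ps) = inv_excess (map snd ps)"
    and "p \<in> set ps" "q \<in> set ps"
  shows "cmp (fst p) (fst q) = cmp (snd p) (snd q)"
  using assms
proof (induction ps)
  case (Cons r ps)
  have "inv_excess (map fst ps) \<le> inv_excess (map snd ps)"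
    using Cons.prems by (intro inv_excess_mono) simp
  moreover have "(\<Sum>y\<leftarrow>map fst ps. cmp (fst r) y) \<le> (\<Sum>y\<leftarrow>map snd ps. cmp (snd r) y)"
    using Cons.prems by (intro sum_list_cmp_mono) simp
  ultimately have *: "inv_excess (map fst ps) = inv_excess (map snd ps)"
    "(\<Sum>y\<leftarrow>map fst ps. cmp (fst r) y) = (\<Sum>y\<leftarrow>map snd ps. cmp (snd r) y)"
    using Cons.prems by simp_all
  have "\<forall>q\<in>set ps. cmp (fst r) (fst q) = cmp (snd r) (snd q)"
    using Cons.prems *(2) by (intro sum_list_cmp_eq) simp_all
  \<comment> \<open>Membership does not fix the order of \<open>p\<close> and \<open>q\<close>:
    either may be the head \<open>r\<close>, or both. \<open>cmp_swap\<close> settles the reversed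
    case and \<open>cmp_refl\<close> the case of equality.\<close>
  then show ?case
    using Cons * cmp_swap by (metis cmp_refl set_ConsD sorted_wrt.simps(2))
qed simp

definition excess_less :: "nat list \<Rightarrow> nat list \<Rightarrow> bool" where
  "excess_less a b \<longleftrightarrow> desc_excess a < desc_excess b \<or>
     desc_excess a = desc_excess b \<and> inv_excess a < inv_excess b"

lemma excess_less_remdups_adj:
  assumes le: "sorted_wrt cmp_le ps"
    and strict: "p \<in> set ps" "q \<in> set ps" "cmp (fst p) (fst q) \<noteq> cmp (snd p) (snd q)"
  shows "excess_less (remdups_adj (map fst ps)) (remdups_adj (map snd ps))"
proof (cases "desc_excess (map fst ps) = desc_excess (map snd ps)")
  case True
  let ?rs = "remdups_adj ps"
  have "inv_excess (map fst ?rs) \<le> inv_excess (map snd ?rs)"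
    using le by (intro inv_excess_mono sorted_wrt_remdups_adj)
  \<comment> \<open>Contraction keeps the set of entries, so the pair with differing signs is still
    present in \<open>?rs\<close>.\<close>
  moreover have "inv_excess (map fst ?rs) \<noteq> inv_excess (map snd ?rs)"
    using inv_excess_eq[of ?rs p q] sorted_wrt_remdups_adj[OF le] strict by auto
  ultimately show ?thesis
    using True remdups_adj_map_fst_snd[OF le True]
    by (metis desc_excess_remdups_adj excess_less_def order_le_imp_less_or_eq)
next
  case False
  then show ?thesis
    using desc_excess_mono[OF le] by (simp add: excess_less_def desc_excess_remdups_adj)
qed

lemma excess_less_trans: "excess_less a b \<Longrightarrow> excess_less b c \<Longrightarrow> excess_less a c"
  by (auto simp: excess_less_def)

lemma excess_less_irrefl: "\<not> excess_less a a"
  by (simp add: excess_less_def)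

section \<open>Position words and their invariance under standardization steps\<close>

definition pos :: "word \<Rightarrow> nat \<Rightarrow> nat" where
  "pos w x = (THE j. j < length w \<and> x \<in> w ! j)"

text \<open>The letters are taken from the union of the blocks, not from an interval, so that words
  with missing letters inside a standardization are covered.\<close>

definition red :: "word \<Rightarrow> nat list" where
  "red w = remdups_adj (map (pos w) (sorted_list_of_set (\<Union> (set w))))"

text \<open>The part of being a set composition that survives every standardization step, where gaps
  may appear among the letters. Nonemptiness of the word excludes the composition of the empty
  set.\<close>

definition letters_ok :: "word \<Rightarrow> bool" where
  "letters_ok w \<longleftrightarrow> {} \<notin> set w \<and> sorted_wrt disjnt w \<and> finite (\<Union> (set w)) \<and>
     0 \<notin> \<Union> (set w) \<and> w \<noteq> []"

lemma sorted_wrt_disjntD: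
  assumes "sorted_wrt disjnt w" "i < length w" "j < length w" "x \<in> w ! i" "x \<in> w ! j"
  shows "i = j"
proof -
  have "disjnt (w ! i) (w ! j)" if "i < j" "j < length w" for i j
    using assms(1) that by (simp add: sorted_wrt_iff_nth_less)
  then show ?thesis
    using assms(2-5) by (metis disjnt_iff linorder_neqE_nat)
qed

lemma pos_eq:
  assumes "sorted_wrt disjnt w" "j < length w" "x \<in> w ! j"
  shows "pos w x = j"
  unfolding pos_def using assms sorted_wrt_disjntD[OF assms(1)] by blast

lemma pos_props:
  assumes "sorted_wrt disjnt w" "x \<in> \<Union> (set w)"
  shows "pos w x < length w" "x \<in> w ! pos w x"
  using assms pos_eq by (auto simp: in_set_conv_nth)

lemma remdups_adj_dup: "remdups_adj (xs @ x # x # ys) = remdups_adj (xs @ x # ys)"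
  by (induction xs rule: remdups_adj.induct) simp_all

lemma sorted_list_of_set_delete_Suc:
  assumes "finite S" "i \<in> S" "Suc i \<in> S"
  obtains xs ys where "sorted_list_of_set S = xs @ i # Suc i # ys"
    "sorted_list_of_set (S - {Suc i}) = xs @ i # ys"
proof -
  let ?xs = "sorted_list_of_set {x \<in> S. x < i}" and ?ys = "sorted_list_of_set {x \<in> S. x > Suc i}"
  have "sorted_list_of_set S = ?xs @ i # Suc i # ?ys"
    using assms by (intro strict_sorted_equal) (auto simp: sorted_wrt_append)
  moreover have "sorted_list_of_set (S - {Suc i}) = ?xs @ i # ?ys"
    using assms by (intro strict_sorted_equal) (auto simp: sorted_wrt_append)
  ultimately show ?thesis
    using that by blast
qed

lemma sorted_list_of_set_image_strict_mono_on:
  assumes "finite S" "\<And>x y. x \<in> S \<Longrightarrow> y \<in> S \<Longrightarrow> x < y \<Longrightarrow> h x < (h y :: nat)"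
  shows "sorted_list_of_set (h ` S) = map h (sorted_list_of_set (S :: nat set))"
proof (intro strict_sorted_equal)
  show "sorted_wrt (<) (map h (sorted_list_of_set S))"
    unfolding sorted_wrt_map
    using assms by (intro sorted_wrt_mono_rel[OF _ strict_sorted_list_of_set]) auto
qed (use assms in auto)

text \<open>By disjointness \<open>c\<close> lies in no other block. In this form R1, like R2, is a
  map over the blocks, as \<open>letters_ok_map\<close> expects.\<close>

lemma delete_Suc_block:
  assumes "sorted_wrt disjnt w" "j < length w" "c \<in> w ! j"
  shows "w[j := w ! j - {c}] = map (\<lambda>B. B - {c}) w"
proof (rule nth_equalityI)
  fix k
  assume "k < length (w[j := w ! j - {c}])"
  then show "w[j := w ! j - {c}] ! k = map (\<lambda>B. B - {c}) w ! k"
    using assms sorted_wrt_disjntD[OF assms(1), of k j c] by (cases "k = j") auto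
qed simp

lemma letters_ok_map:
  assumes "letters_ok w"
    and "\<And>B. B \<in> set w \<Longrightarrow> g B \<noteq> {} \<and> finite (g B) \<and> 0 \<notin> g B"
    and "\<And>A B. A \<in> set w \<Longrightarrow> B \<in> set w \<Longrightarrow> disjnt A B \<Longrightarrow> disjnt (g A) (g B)"
  shows "letters_ok (map g w)"
proof -
  have "sorted_wrt (\<lambda>A B. disjnt (g A) (g B)) w"
    using assms(1) unfolding letters_ok_def
    by (elim conjE) (rule sorted_wrt_mono_rel[OF assms(3)])
  moreover have "{} \<notin> set (map g w)" "0 \<notin> \<Union> (set (map g w))" "finite (\<Union> (set (map g w)))"
    unfolding set_map using assms(2) by blast+
  ultimately show ?thesis
    using assms(1) by (simp add: letters_ok_def sorted_wrt_map)
qed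

text \<open>R1 deletes a letter whose predecessor lies in the same block, which shortens an adjacent
  repetition of the position word. R2 relabels the letters by a map that is strictly increasing on
  those present, which leaves the position word as it is.\<close>

lemma st_step_invariant:
  assumes "st_step w v" "letters_ok w"
  shows "letters_ok v \<and> red v = red w"
  using assms
proof (cases rule: st_step.cases)
  case (R1 j i)
  have disj: "sorted_wrt disjnt w" and fin: "finite (\<Union> (set w))"
    using assms(2) by (simp_all add: letters_ok_def)
  have v: "v = map (\<lambda>B. B - {Suc i}) w"
    using R1 delete_Suc_block[OF disj, of j "Suc i"] by simp
  \<comment> \<open>Only block \<open>j\<close> loses a letter, and it keeps
    \<open>i\<close>.\<close>
  have "B - {Suc i} \<noteq> {}" if "B \<in> set w" for B
  proof (cases "Suc i \<in> B")
    case True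
    obtain k where "k < length w" "B = w ! k"
      using \<open>B \<in> set w\<close> by (metis in_set_conv_nth)
    then have "B = w ! j"
      using sorted_wrt_disjntD[OF disj, of k j "Suc i"] R1 True by simp
    then show ?thesis
      using R1 by auto
  next
    case False
    then show ?thesis
      using that assms(2) by (auto simp: letters_ok_def)
  qed
  moreover have "finite (B - {Suc i}) \<and> 0 \<notin> B - {Suc i}" if B: "B \<in> set w" for B
    using finite_subset[OF Union_upper[OF B] fin] B assms(2) by (auto simp: letters_ok_def)
  moreover have "disjnt (A - {Suc i}) (B - {Suc i})" if "disjnt A B" for A B
    using that by (auto simp: disjnt_iff)
  ultimately have "letters_ok v"
    unfolding v using assms(2) by (intro letters_ok_map) simp_all
  have union: "\<Union> (set v) = \<Union> (set w) - {Suc i}"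
    by (auto simp: v)
  have pos: "pos v x = pos w x" if "x \<noteq> Suc i" for x
    using that by (auto simp: pos_def v cong: conj_cong)
  have same: "pos w (Suc i) = pos w i"
    using pos_eq[OF disj, of j] R1 by simp
  have "i \<in> \<Union> (set w)" "Suc i \<in> \<Union> (set w)"
    using UnionI[OF nth_mem[OF R1(2)]] R1(3,4) unfolding Suc_eq_plus1 by blast+
  then obtain xs ys where xs: "sorted_list_of_set (\<Union> (set w)) = xs @ i # Suc i # ys"
    "sorted_list_of_set (\<Union> (set w) - {Suc i}) = xs @ i # ys"
    using sorted_list_of_set_delete_Suc[OF fin] by metis
  have "Suc i \<notin> set (xs @ i # ys)"
    using xs(2) fin by (metis Diff_iff finite_Diff insertI1 set_sorted_list_of_set)
  then have "map (pos v) (xs @ i # ys) = map (pos w) (xs @ i # ys)"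
    by (intro map_cong refl pos) auto
  then have "red v = red w"
    unfolding red_def union xs by (simp only: list.map map_append same remdups_adj_dup)
  with \<open>letters_ok v\<close> show ?thesis by simp
next
  case (R2 i)
  define h where "h = (\<lambda>x. if x > i then x - 1 else x)"
  have v: "v = map ((`) h) w"
    using R2 by (simp add: h_def)
  have disj: "sorted_wrt disjnt w" and fin: "finite (\<Union> (set w))"
    using assms(2) by (simp_all add: letters_ok_def)
  \<comment> \<open>The only two numbers that \<open>h\<close> identifies are \<open>i\<close> and
    \<open>i + 1\<close>, and \<open>i\<close> is absent.\<close>
  have mono: "h x < h y" if "x \<in> \<Union> (set w)" "y \<in> \<Union> (set w)" "x < y" for x y
  proof -
    have "x \<noteq> i" "y \<noteq> i"
      using that R2 by auto
    then show ?thesis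
      using \<open>x < y\<close> by (auto simp: h_def)
  qed
  then have inj: "inj_on h (\<Union> (set w))"
    by (intro inj_onI) (metis linorder_neqE_nat less_irrefl)
  \<comment> \<open>A letter that is lowered exceeds \<open>i \<ge> 1\<close>, so it stays
    positive.\<close>
  have h0: "h x \<noteq> 0" if "x \<noteq> 0" for x
    using that R2(2) by (auto simp: h_def)
  have "h ` B \<noteq> {} \<and> finite (h ` B) \<and> 0 \<notin> h ` B" if B: "B \<in> set w" for B
  proof -
    have "finite B"
      using finite_subset[OF Union_upper[OF B] fin] .
    moreover have "B \<noteq> {}" "0 \<notin> B"
      using B assms(2) by (auto simp: letters_ok_def)
    ultimately show ?thesis
      using h0 by (metis finite_imageI image_iff image_is_empty)
  qed
  moreover have "disjnt (h ` A) (h ` B)" if "A \<in> set w" "B \<in> set w" "disjnt A B" for A B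
    using that by (fastforce simp: disjnt_iff dest: inj_onD[OF inj])
  ultimately have ok: "letters_ok v"
    unfolding v using assms(2)
    by (intro letters_ok_map) simp_all
  have union: "\<Union> (set v) = h ` \<Union> (set w)"
    by (auto simp: v)
  have sorted: "sorted_list_of_set (h ` \<Union> (set w)) = map h (sorted_list_of_set (\<Union> (set w)))"
    by (rule sorted_list_of_set_image_strict_mono_on[OF fin]) (rule mono)
  have "pos v (h x) = pos w x" if "x \<in> \<Union> (set w)" for x
    using ok pos_props[OF disj that] by (intro pos_eq) (auto simp: letters_ok_def v)
  then have "map (pos v) (map h (sorted_list_of_set (\<Union> (set w))))
      = map (pos w) (sorted_list_of_set (\<Union> (set w)))"
    using fin by simp
  then have "red v = red w"
    unfolding red_def union sorted by (rule arg_cong[where f = remdups_adj])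
  then show ?thesis
    using ok by simp
qed

lemma st_steps_invariant:
  "st_step\<^sup>*\<^sup>* w v \<Longrightarrow> letters_ok w \<Longrightarrow> letters_ok v \<and> red v = red w"
proof (induction rule: rtranclp_induct)
  case (step u v)
  then show ?case
    using st_step_invariant[of u v] by simp
qed simp

lemma letters_ok_SC_inf:
  assumes "w \<in> SC_inf"
  shows "letters_ok w"
proof -
  obtain n where "{} \<notin> set w" "sorted_wrt disjnt w" and n: "\<Union> (set w) = {1..n}" "n \<ge> 1"
    using assms unfolding SC_inf_def SC_def by blast
  moreover have "w \<noteq> []"
    using n by fastforce
  ultimately show ?thesis
    unfolding letters_ok_def n(1) by simp
qed

section \<open>M-permutations as canonical representatives of the classes\<close>

lemma red_SC: "w \<in> SC n \<Longrightarrow> red w = remdups_adj (map (pos w) [1..<Suc n])"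
  by (simp add: red_def SC_def atLeastLessThanSuc_atLeastAtMost[symmetric]
      del: upt_Suc)

text \<open>No block is empty, so every index is attained. This lets the number of blocks be read
  off the position word.\<close>

lemma pos_image_SC:
  assumes "w \<in> SC n"
  shows "pos w ` {1..n} = {..<length w}"
proof -
  have w: "{} \<notin> set w" "sorted_wrt disjnt w" "\<Union> (set w) = {1..n}"
    using assms by (auto simp: SC_def)
  have "j \<in> pos w ` {1..n}" if j: "j < length w" for j
  proof -
    obtain x where "x \<in> w ! j"
      using w(1) nth_mem[OF j] by fastforce
    moreover from this have "x \<in> {1..n}"
      using w(3) nth_mem[OF j] by blast
    ultimately show ?thesis
      using pos_eq[OF w(2) j] by force
  qed
  then show ?thesis
    using pos_props(1)[OF w(2)] unfolding w(3) by auto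
qed

text \<open>Consecutive letters lie in different blocks, so the position word has no adjacent
  repetition and contraction does not change it.\<close>

lemma red_M_perms:
  assumes "w \<in> M_perms n"
  shows "red w = map (pos w) [1..<Suc n]"
proof -
  have SC: "w \<in> SC n" and M: "\<forall>B\<in>set w. \<nexists>i. i \<in> B \<and> i + 1 \<in> B"
    using assms by (auto simp: M_perms_def)
  have w: "sorted_wrt disjnt w" "\<Union> (set w) = {1..n}"
    using SC by (auto simp: SC_def)
  have "pos w x \<noteq> pos w (Suc x)" if "x \<ge> 1" "Suc x \<le> n" for x
  proof
    assume eq: "pos w x = pos w (Suc x)"
    have "x \<in> w ! pos w x" "Suc x \<in> w ! pos w x" "pos w x < length w"
      using pos_props[OF w(1), of x] pos_props[OF w(1), of "Suc x"] that eq
      unfolding w(2) by auto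
    then show False
      using M nth_mem[of "pos w x" w] by auto
  qed
  then have "distinct_adj (map (pos w) [1..<Suc n])"
    by (auto simp: distinct_adj_conv_nth simp del: upt_Suc)
  then show ?thesis
    unfolding red_SC[OF SC] by (simp only: distinct_adj_altdef)
qed

text \<open>For an M-permutation \<open>red\<close> is the full position word. Its length gives
  \<open>n\<close>, its range the number of blocks, and its fibres the blocks themselves.\<close>

lemma inj_on_red: "inj_on red SM_inf"
proof (rule inj_onI)
  fix w v
  assume "w \<in> SM_inf" "v \<in> SM_inf" and eq: "red w = red v"
  then obtain n m where w: "w \<in> M_perms n" and v: "v \<in> M_perms m"
    by (auto simp: SM_inf_def)
  have nm: "n = m"
    using eq red_M_perms[OF w] red_M_perms[OF v] by (metis diff_Suc_1 length_map length_upt)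
  have pos: "pos w x = pos v x" if "x \<in> {1..n}" for x
    using that eq unfolding red_M_perms[OF w] red_M_perms[OF v] nm
    by (simp add: map_eq_conv del: upt_Suc)
  have SC: "w \<in> SC n" "v \<in> SC n"
    using w v nm by (auto simp: M_perms_def)
  have "{..<length w} = {..<length v}"
    unfolding pos_image_SC[OF SC(1), symmetric] pos_image_SC[OF SC(2), symmetric]
    using pos by (intro image_cong) auto
  then have len: "length w = length v"
    by (simp add: lessThan_eq_iff)
  have block: "u ! j = {x \<in> {1..n}. pos u x = j}" if "u \<in> SC n" "j < length u" for u j
  proof -
    have u: "sorted_wrt disjnt u" "\<Union> (set u) = {1..n}"
      using that by (auto simp: SC_def)
    have "u ! j \<subseteq> {1..n}"
      using u(2) that(2) nth_mem by blast
    then show ?thesis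
      using pos_eq[OF u(1) that(2)] pos_props(2)[OF u(1)] unfolding u(2) by blast
  qed
  show "w = v"
  proof (rule nth_equalityI)
    fix j
    assume "j < length w"
    then show "w ! j = v ! j"
      using block[OF SC(1)] block[OF SC(2)] len pos by auto
  qed (rule len)
qed

text \<open>The sum of all letters terminates the process: R1 removes a positive letter, and R2 at a
  gap lowers every letter above it. A word where neither is possible is an M-permutation.\<close>

lemma ex_standardization:
  assumes "letters_ok w"
  shows "\<exists>v\<in>SM_inf. st_step\<^sup>*\<^sup>* w v"
  using assms
proof (induction "\<Sum> (\<Union> (set w))" arbitrary: w rule: less_induct)
  case less
  have w: "{} \<notin> set w" "sorted_wrt disjnt w" "finite (\<Union> (set w))" "0 \<notin> \<Union> (set w)" "w \<noteq> []"
    using less.prems by (auto simp: letters_ok_def)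
  have reduce: ?case if step: "st_step w v" and "\<Sum> (\<Union> (set v)) < \<Sum> (\<Union> (set w))" for v
  proof -
    have "letters_ok v"
      using st_step_invariant[OF step] less.prems by simp
    then show ?thesis
      using less.hyps[OF that(2)] step by (meson converse_rtranclp_into_rtranclp)
  qed
  show ?case
  proof (cases "\<exists>j i. j < length w \<and> i \<in> w ! j \<and> i + 1 \<in> w ! j")
    case True
    then obtain j i where ji: "j < length w" "i \<in> w ! j" "i + 1 \<in> w ! j"
      by blast
    let ?v = "w[j := w ! j - {i + 1}]"
    have "\<Union> (set ?v) = \<Union> (set w) - {i + 1}"
      unfolding delete_Suc_block[OF w(2) ji(1,3)] by auto
    moreover have "i + 1 \<in> \<Union> (set w)"
      using ji nth_mem by blast
    ultimately have "\<Sum> (\<Union> (set ?v)) < \<Sum> (\<Union> (set w))"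
      using w(3) by (simp add: sum.remove[of "\<Union> (set w)" "i + 1" "\<lambda>x. x"])
    then show ?thesis
      using reduce st_step.R1[OF ji] by blast
  next
    case noR1: False
    show ?thesis
    \<comment> \<open>R2 also applies to an absent \<open>i\<close> above all letters, where it
      changes nothing. Asking for a letter \<open>x\<close> above \<open>i\<close> makes the sum
      drop.\<close>
    proof (cases "\<exists>i x. 1 \<le> i \<and> i \<notin> \<Union> (set w) \<and> x \<in> \<Union> (set w) \<and> i < x")
      case True
      then obtain i x where ix: "1 \<le> i" "i \<notin> \<Union> (set w)" "x \<in> \<Union> (set w)" "i < x"
        by blast
      let ?h = "\<lambda>x. if x > i then x - 1 else x"
      let ?v = "map ((`) ?h) w"
      have "\<Union> (set ?v) = ?h ` \<Union> (set w)"
        by auto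
      then have "\<Sum> (\<Union> (set ?v)) \<le> (\<Sum>x\<in>\<Union> (set w). ?h x)"
        using sum_image_le[OF w(3), of "\<lambda>x. x" ?h] by (simp only: o_def)
      also have "(\<Sum>x\<in>\<Union> (set w). ?h x) < \<Sum> (\<Union> (set w))"
        using ix w(3) by (intro sum_strict_mono_ex1) auto
      finally show ?thesis
        using reduce st_step.R2[OF ix(1,2)] by blast
    next
      case False
      \<comment> \<open>No positive integer below a letter is missing, so the letters fill the
        interval from 1 to their maximum.\<close>
      define n where "n = Max (\<Union> (set w))"
      have "\<Union> (set w) \<noteq> {}"
        using w(1,5) by (metis Sup_bot_conv(1) list.set_sel(1))
      then have n: "n \<in> \<Union> (set w)"
        unfolding n_def using w(3) Max_in by blast
      have le: "x \<le> n" if "x \<in> \<Union> (set w)" for x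
        unfolding n_def using w(3) that by (rule Max_ge)
      have ge: "x \<ge> 1" if "x \<in> \<Union> (set w)" for x
        using that w(4) by (metis less_one not_less)
      have mem: "i \<in> \<Union> (set w)" if "i \<in> {1..n}" for i
        using False n that by (metis atLeastAtMost_iff order_le_less)
      have union: "\<Union> (set w) = {1..n}"
      proof (intro equalityI subsetI)
        fix x
        assume "x \<in> \<Union> (set w)"
        from ge[OF this] le[OF this] show "x \<in> {1..n}"
          by (simp only: atLeastAtMost_iff)
      qed (rule mem)
      then have "w \<in> M_perms n"
        unfolding M_perms_def SC_def using noR1 w(1,2) by (fastforce simp: in_set_conv_nth)
      then have "w \<in> SM_inf"
        using ge[OF n] by (auto simp: SM_inf_def)
      then show ?thesis
        by blast
    qed
  qed
qed

text \<open>The description in \<open>st\<close> denotes: an M-permutation is reachable, and any two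
  reachable ones share the value of \<open>red\<close>, hence coincide by
  \<open>inj_on_red\<close>.\<close>

lemma red_st:
  assumes "w \<in> SC_inf"
  shows "red (st w) = red w"
proof -
  have ok: "letters_ok w"
    using assms by (rule letters_ok_SC_inf)
  obtain v where v: "v \<in> SM_inf" "st_step\<^sup>*\<^sup>* w v"
    using ex_standardization[OF ok] by blast
  have "u = v" if "u \<in> SM_inf" "st_step\<^sup>*\<^sup>* w u" for u
    using st_steps_invariant[OF that(2) ok] st_steps_invariant[OF v(2) ok]
    by (intro inj_onD[OF inj_on_red _ that(1) v(1)]) simp
  with v have "st w = v"
    unfolding st_def by (intro the_equality) blast+
  then show ?thesis
    using st_steps_invariant[OF v(2) ok] by simp
qed

lemma red_sc_equiv:
  assumes "sc_equiv w v"
  shows "red w = red v"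
proof -
  have "equivclp (\<lambda>x y. x \<in> SC_inf \<and> y = st x) w v"
    using assms by (simp add: sc_equiv_def)
  then show ?thesis
  proof (induction rule: equivclp_induct)
    case (step y z)
    then show ?case
      using red_st[of y] red_st[of z] by metis
  qed simp
qed

section \<open>Growth of the excess along covers, and the weak order\<close>

lemma excess_less_red_SC:
  assumes "w \<in> SC n" "v \<in> SC n"
    and le: "\<And>x y. x \<in> {1..n} \<Longrightarrow> y \<in> {1..n} \<Longrightarrow> x < y \<Longrightarrow>
      cmp (pos w x) (pos w y) \<le> cmp (pos v x) (pos v y)"
    and strict: "x \<in> {1..n}" "y \<in> {1..n}" "cmp (pos w x) (pos w y) \<noteq> cmp (pos v x) (pos v y)"
  shows "excess_less (red w) (red v)"
proof -
  \<comment> \<open>The two uncontracted position words side by side, in increasing order of the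
    letters.\<close>
  let ?ps = "map (\<lambda>x. (pos w x, pos v x)) [1..<Suc n]"
  have "sorted_wrt cmp_le ?ps"
    unfolding sorted_wrt_map cmp_le_def fst_conv snd_conv
  proof (rule sorted_wrt_mono_rel[OF _ sorted_wrt_upt])
    fix x y
    assume "x \<in> set [1..<Suc n]" "y \<in> set [1..<Suc n]" "x < y"
    then show "cmp (pos w x) (pos w y) \<le> cmp (pos v x) (pos v y)"
      by (intro le) (simp_all del: upt_Suc)
  qed
  moreover have mem: "(pos w x, pos v x) \<in> set ?ps" "(pos w y, pos v y) \<in> set ?ps"
    using strict(1,2) by (auto simp del: upt_Suc)
  ultimately have "excess_less (remdups_adj (map fst ?ps)) (remdups_adj (map snd ?ps))"
    using excess_less_remdups_adj[OF _ mem] strict(3) by simp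
  then show ?thesis
    using assms(1,2) by (simp add: red_SC comp_def del: upt_Suc)
qed

lemma pos_append:
  assumes "sorted_wrt disjnt (us @ B # vs)"
  shows "x \<in> B \<Longrightarrow> pos (us @ B # vs) x = length us"
    and "x \<in> us ! j \<Longrightarrow> j < length us \<Longrightarrow> pos (us @ B # vs) x = j"
    and "x \<in> vs ! j \<Longrightarrow> j < length vs \<Longrightarrow> pos (us @ B # vs) x = Suc (length us + j)"
  using assms by (auto intro!: pos_eq simp: nth_append)

lemma set_lessD:
  assumes "set_less A B" "finite A" "finite B" "x \<in> A" "y \<in> B"
  shows "x < y"
proof -
  have "x \<le> Max A" "Min B \<le> y"
    using assms by simp_all
  then show ?thesis
    using assms(1) by (simp add: set_less_def)
qed

lemma letter_cases:
  assumes "x \<in> \<Union> (set (us @ A # B # vs))"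
  obtains (us) j where "x \<in> us ! j" "j < length us"
  | (A) "x \<in> A"
  | (B) "x \<in> B"
  | (vs) j where "x \<in> vs ! j" "j < length vs"
  using assms by (auto simp: in_set_conv_nth)

lemma pos_two_blocks:
  assumes "sorted_wrt disjnt (us @ A # B # vs)"
  shows "x \<in> A \<Longrightarrow> pos (us @ A # B # vs) x = length us"
    and "x \<in> B \<Longrightarrow> pos (us @ A # B # vs) x = Suc (length us)"
    and "x \<in> us ! j \<Longrightarrow> j < length us \<Longrightarrow> pos (us @ A # B # vs) x = j"
    and "x \<in> vs ! j \<Longrightarrow> j < length vs \<Longrightarrow> pos (us @ A # B # vs) x = Suc (Suc (length us + j))"
  using assms by (auto intro!: pos_eq simp: nth_append)

text \<open>For \<open>x\<close> in \<open>A\<close> and \<open>y\<close> in \<open>B\<close>, where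
  \<open>x < y\<close>, merging raises the sign from -1 to 0 and splitting raises it from 0 to 1.
  All other pairs of blocks keep their relative order, as later blocks are only shifted.\<close>

lemma cover_excess_less:
  assumes "cover n w v" "w \<in> SC n" "v \<in> SC n"
  shows "excess_less (red w) (red v)"
  using assms(1)
proof cases
  case (merge us A B vs)
  have disj: "sorted_wrt disjnt (us @ A # B # vs)" "sorted_wrt disjnt (us @ (A \<union> B) # vs)"
    and letters: "\<Union> (set (us @ A # B # vs)) = {1..n}" and ne: "A \<noteq> {}" "B \<noteq> {}"
    using assms(2,3) unfolding merge SC_def by auto
  note pos_w = pos_two_blocks[OF disj(1)] and pos_v = pos_append[OF disj(2)]
  have sub: "A \<subseteq> {1..n}" "B \<subseteq> {1..n}"
    unfolding letters[symmetric] by auto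
  note AB = set_lessD[OF merge(4) sub[THEN finite_subset[OF _ finite_atLeastAtMost]]]
  obtain x y where xy: "x \<in> A" "y \<in> B"
    using ne by blast
  show ?thesis
  proof (rule excess_less_red_SC[OF assms(2,3)])
    fix x y
    assume "x \<in> {1..n}" "y \<in> {1..n}" "x < y"
    then have "x \<in> \<Union> (set (us @ A # B # vs))" "y \<in> \<Union> (set (us @ A # B # vs))"
      using letters by blast+
    \<comment> \<open>The sign would drop only for \<open>x\<close> in \<open>B\<close> and
      \<open>y\<close> in \<open>A\<close>, which \<open>AB[of y x]\<close> excludes because
      \<open>x < y\<close>.\<close>
    then show "cmp (pos w x) (pos w y) \<le> cmp (pos v x) (pos v y)"
      unfolding merge(1,2) using \<open>x < y\<close> AB[of y x]
      by (elim letter_cases) (simp_all add: pos_w pos_v cmp_def)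
  next
    show "cmp (pos w x) (pos w y) \<noteq> cmp (pos v x) (pos v y)"
      unfolding merge(1,2) using xy by (simp add: pos_w pos_v cmp_def)
  qed (use xy sub in auto)
next
  case (split us A B vs)
  have disj: "sorted_wrt disjnt (us @ (A \<union> B) # vs)" "sorted_wrt disjnt (us @ B # A # vs)"
    and letters: "\<Union> (set (us @ B # A # vs)) = {1..n}"
    using assms(2,3) unfolding split SC_def by auto
  note pos_w = pos_append[OF disj(1)] and pos_v = pos_two_blocks[OF disj(2)]
  have sub: "A \<subseteq> {1..n}" "B \<subseteq> {1..n}"
    unfolding letters[symmetric] by auto
  note AB = set_lessD[OF split(7) sub[THEN finite_subset[OF _ finite_atLeastAtMost]]]
  obtain x y where xy: "x \<in> A" "y \<in> B"
    using split(4,5) by blast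
  show ?thesis
  proof (rule excess_less_red_SC[OF assms(2,3)])
    fix x y
    assume "x \<in> {1..n}" "y \<in> {1..n}" "x < y"
    then have "x \<in> \<Union> (set (us @ B # A # vs))" "y \<in> \<Union> (set (us @ B # A # vs))"
      using letters by blast+
    then show "cmp (pos w x) (pos w y) \<le> cmp (pos v x) (pos v y)"
      unfolding split(1,2) using \<open>x < y\<close> AB[of y x]
      by (elim letter_cases) (simp_all add: pos_w pos_v cmp_def)
  next
    show "cmp (pos w x) (pos w y) \<noteq> cmp (pos v x) (pos v y)"
      unfolding split(1,2) using xy by (simp add: pos_w pos_v cmp_def)
  qed (use xy sub in auto)
qed

text \<open>A generating relation is witnessed by a cover between other members of the two classes.
  Since \<open>red\<close> is a class invariant, the comparison passes to the M-permutations, and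
  then along chains by transitivity.\<close>

lemma weak_less_excess_less:
  assumes "(w, v) \<in> weak_less"
  shows "w \<in> SM_inf \<and> v \<in> SM_inf \<and> excess_less (red w) (red v)"
  using assms unfolding weak_less_def
proof (induction rule: trancl_induct)
  case (base v)
  then show ?case
    using cover_excess_less red_sc_equiv by fastforce
next
  case (step u v)
  then have "excess_less (red u) (red v)"
    using cover_excess_less red_sc_equiv by fastforce
  with step show ?case
    using excess_less_trans by blast
qed

theorem theorem7p11:
  shows "partial_order_on SM_inf weak_order"
proof -
  have "trans weak_less"
    by (simp add: weak_less_def)
  then have "trans weak_order"
    by (auto simp: weak_order_def trans_def)
  \<comment> \<open>Strict relations in both directions would give \<open>excess_less\<close>
    between a word and itself.\<close>
  moreover have "antisym weak_order"
    unfolding antisym_def weak_order_def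
    using weak_less_excess_less excess_less_trans excess_less_irrefl by blast
  moreover have "weak_order \<subseteq> SM_inf \<times> SM_inf"
    using weak_less_excess_less by (auto simp: weak_order_def)
  moreover have "refl_on SM_inf weak_order"
    by (auto simp: weak_order_def refl_on_def)
  ultimately show ?thesis
    by (simp add: partial_order_on_def preorder_on_def)
qed

end
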